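(* If $s\ge 1$ is an odd integer, then $$\mathrm{Rs}(K_{1,s})=(\mathrm{R}(K_{1,s})-1)^2+1-(2s-2)=(2s-1)(2s-2)+2 .$$
   Context: All graphs are finite and simple. $K_{1,s}$ is the star with $s$ edges. A (not necessarily induced) subgraph $H$ of a host graph $F$ is singular if the degrees $d_F(v)$, $v\in V(H)$, taken in $F$, are all equal or pairwise distinct. In an edge 2-coloring of $K_m$, the host graph of a color is the spanning graph on all $m$ vertices formed by the edges of that color. The singular Ramsey number $\mathrm{Rs}(G)$ is the smallest integer $N$ such that for every $m\ge N$ and every 2-coloring of the edges of $K_m$, at least one of the two color graphs contains a singular subgraph isomorphic to $G$. $\mathrm{R}(G)$ is the ordinary (2-color, diagonal) Ramsey number of $G$. *)

theory Defs
  imports "HOL-Library.Ramsey"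
begin

text \<open>
  A graph is a pair of a vertex set and a set of edges, the edges being two-element
  sets of vertices.
\<close>

type_synonym 'a graph = "'a set \<times> 'a set set"

abbreviation verts :: "'a graph \<Rightarrow> 'a set" where
  "verts G \<equiv> fst G"

abbreviation edges :: "'a graph \<Rightarrow> 'a set set" where
  "edges G \<equiv> snd G"

definition simple_graph :: "'a graph \<Rightarrow> bool" where
  "simple_graph G \<longleftrightarrow> finite (verts G) \<and> edges G \<subseteq> nsets (verts G) 2"

definition degree :: "'a graph \<Rightarrow> 'a \<Rightarrow> nat" where
  "degree G v = card {e \<in> edges G. v \<in> e}"

definition subgraph :: "'a graph \<Rightarrow> 'a graph \<Rightarrow> bool" where
  "subgraph H F \<longleftrightarrow> simple_graph H \<and> verts H \<subseteq> verts F \<and> edges H \<subseteq> edges F"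

definition isomorphic :: "'a graph \<Rightarrow> 'b graph \<Rightarrow> bool" where
  "isomorphic G H \<longleftrightarrow>
     (\<exists>f. bij_betw f (verts G) (verts H) \<and> edges H = (\<lambda>e. f ` e) ` edges G)"

text \<open>Degrees are taken in the host graph \<open>F\<close>, not in \<open>H\<close>.\<close>

definition singular :: "'a graph \<Rightarrow> 'a graph \<Rightarrow> bool" where
  "singular H F \<longleftrightarrow>
     (\<forall>u\<in>verts H. \<forall>v\<in>verts H. degree F u = degree F v) \<or> inj_on (degree F) (verts H)"

text \<open>
  The complete graph on \<open>m\<close> vertices has vertex set \<open>{..<m}\<close>. The two colors are the
  booleans, and only the values of a coloring on \<open>nsets {..<m} 2\<close> matter.
\<close>

definition color_graph :: "nat \<Rightarrow> (nat set \<Rightarrow> bool) \<Rightarrow> bool \<Rightarrow> nat graph" where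
  "color_graph m c k = ({..<m}, {e \<in> nsets {..<m} 2. c e = k})"

definition Ramsey_number :: "'a graph \<Rightarrow> nat" where
  "Ramsey_number G =
     (LEAST N. \<forall>c. \<exists>k H. subgraph H (color_graph N c k) \<and> isomorphic G H)"

definition singular_Ramsey_number :: "'a graph \<Rightarrow> nat" where
  "singular_Ramsey_number G =
     (LEAST N. \<forall>m\<ge>N. \<forall>c. \<exists>k H. subgraph H (color_graph m c k) \<and>
        singular H (color_graph m c k) \<and> isomorphic G H)"

text \<open>The star with center \<open>0\<close> and leaves \<open>1, \<dots>, s\<close>.\<close>

definition star :: "nat \<Rightarrow> nat graph" where
  "star s = ({0..s}, {{0, i} |i. i \<in> {1..s}})"

lemma simple_graph_star: "simple_graph (star s)"
  by (auto simp: simple_graph_def star_def nsets_def card_insert_if)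

lemma simple_graph_color_graph: "simple_graph (color_graph m c k)"
  by (auto simp: simple_graph_def color_graph_def)

end

theory Submission
  imports Defs
begin

text \<open>
  The two degrees of a vertex add up to \<open>m - 1\<close>, so two vertices have equal degrees in one
  colour exactly if they have equal degrees in the other, and the colouring splits the vertices into
  common degree classes. A vertex is the centre of a singular \<open>K\<^bsub>1,s\<^esub>\<close> in a colour exactly if it
  has \<open>s\<close> neighbours of that colour in its own class, or neighbours of that colour in \<open>s\<close> other
  classes (\<open>singular_star_iff\<close>).

  Upper bound (\<open>singular_star_exists\<close>). If there is no singular star, a vertex has in each colour at
  most \<open>s - 1\<close> neighbours in its own class, and its other neighbours meet at most \<open>s - 1\<close> classes.
  Hence every class has at most \<open>2s - 1\<close> vertices, and both degrees of every vertex are at most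
  \<open>D = (s - 1) + (s - 1)(2s - 1)\<close>. The red degrees therefore lie between \<open>m - 1 - D\<close> and \<open>D\<close>, a
  window that gets shorter as \<open>m\<close> grows. For \<open>m \<ge> (2s - 1)(2s - 2) + 2\<close> it contains at most
  \<open>2s - 2\<close> integers, so there are at most \<open>2s - 2\<close> classes and \<open>m \<le> (2s - 2)(2s - 1)\<close>, which is
  absurd.

  Lower bound (\<open>avoiding_coloring_exists\<close>). Let \<open>s = 2r + 1\<close>. On one vertex fewer, a colouring without
  singular stars must have \<open>4r + 1\<close> classes of at most \<open>4r + 1\<close> vertices, joined to each other
  according to a \<open>2r\<close>-regular graph on the classes, and in total \<open>4r\<close> vertices are missing from the
  \<open>(4r + 1)\<^sup>2\<close> that classes of full size would have. The red degree of a vertex then drops below the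
  largest possible value \<open>2r + 2r(4r + 1)\<close> by the number of vertices missing from the red
  neighbouring classes, plus what its red degree inside its own class lacks to \<open>2r\<close>. This drop has
  to be different for all classes, and therefore has to take each of the values \<open>0, \<dots>, 4r\<close>. The
  difficulty is to find a regular graph on the classes that spreads the drops so widely. The solution
  used here combines half graphs and threshold graphs, in which almost all degrees are
  distinct, and one class with many missing vertices that separates the remaining coincidences.

  The ordinary Ramsey number is \<open>2s\<close>: a vertex of \<open>K\<^bsub>2s\<^esub>\<close> has \<open>2s - 1\<close> neighbours, and since
  \<open>s - 1 = 2r\<close> is even, there is a \<open>2r\<close>-regular circulant graph on \<open>2s - 1 = 4r + 1\<close> vertices, whose
  complement is \<open>2r\<close>-regular as well.
\<close>

section \<open>Stars in the colour graphs\<close>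

definition nbrs :: "nat \<Rightarrow> (nat set \<Rightarrow> bool) \<Rightarrow> bool \<Rightarrow> nat \<Rightarrow> nat set" where
  "nbrs m c k v = {w. w < m \<and> w \<noteq> v \<and> c {v, w} = k}"

lemma finite_nbrs [simp]: "finite (nbrs m c k v)"
  by (rule finite_subset[of _ "{..<m}"]) (auto simp: nbrs_def)

lemma degree_color_graph:
  assumes "v < m"
  shows "degree (color_graph m c k) v = card (nbrs m c k v)"
proof -
  have "bij_betw (\<lambda>w. {v, w}) (nbrs m c k v) {e \<in> edges (color_graph m c k). v \<in> e}"
  proof (rule bij_betw_imageI)
    show "inj_on (\<lambda>w. {v, w}) (nbrs m c k v)"
      by (auto simp: inj_on_def nbrs_def doubleton_eq_iff)
    show "(\<lambda>w. {v, w}) ` nbrs m c k v = {e \<in> edges (color_graph m c k). v \<in> e}"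
      using assms
      by (auto simp: nbrs_def color_graph_def nsets_def card_2_iff insert_commute image_iff)
  qed
  then show ?thesis
    by (simp add: degree_def bij_betw_same_card)
qed

lemma card_nbrs_add:
  assumes "v < m"
  shows "card (nbrs m c True v) + card (nbrs m c False v) = m - 1"
proof -
  have "nbrs m c True v \<union> nbrs m c False v = {..<m} - {v}"
    by (auto simp: nbrs_def)
  moreover have "nbrs m c True v \<inter> nbrs m c False v = {}"
    by (auto simp: nbrs_def)
  ultimately show ?thesis
    using assms by (metis card_Diff_singleton card_Un_disjoint card_lessThan finite_nbrs lessThan_iff)
qed

text \<open>
  A copy of a star is a centre together with a set of neighbours. The predicate \<open>P\<close> on the vertex set
  lets the same fact serve for singular and for arbitrary stars.
\<close>

lemma star_in_color_graph_iff:
  "(\<exists>H. subgraph H (color_graph m c k) \<and> P (verts H) \<and> isomorphic (star s) H) \<longleftrightarrow>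
   (\<exists>v<m. \<exists>S\<subseteq>nbrs m c k v. card S = s \<and> P (insert v S))"
proof
  assume "\<exists>H. subgraph H (color_graph m c k) \<and> P (verts H) \<and> isomorphic (star s) H"
  then obtain H f where H: "subgraph H (color_graph m c k)" "P (verts H)"
    and f: "bij_betw f {0..s} (verts H)"
    and e: "edges H = (\<lambda>e. f ` e) ` {{0, i} |i. i \<in> {1..s}}"
    by (auto simp: isomorphic_def star_def)
  have split: "{0..s} = insert 0 {1..s}"
    by auto
  have V: "verts H = insert (f 0) (f ` {1..s})"
    using f unfolding bij_betw_def split by (metis image_insert)
  have inj: "inj_on f {0..s}"
    using f by (simp add: bij_betw_def)
  have "f 0 < m"
    using H(1) V by (auto simp: subgraph_def color_graph_def)
  moreover have "f ` {1..s} \<subseteq> nbrs m c k (f 0)"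
  proof
    fix w assume "w \<in> f ` {1..s}"
    then obtain i where i: "i \<in> {1..s}" "w = f i"
      by auto
    then have "f ` {0, i} \<in> edges H"
      unfolding e by blast
    then have "{f 0, w} \<in> edges (color_graph m c k)"
      using H(1) i by (auto simp: subgraph_def)
    then show "w \<in> nbrs m c k (f 0)"
      by (auto simp: color_graph_def nsets_def nbrs_def card_insert_if split: if_splits)
  qed
  moreover have "card (f ` {1..s}) = s"
    using inj by (subst card_image) (auto intro: inj_on_subset)
  ultimately show "\<exists>v<m. \<exists>S\<subseteq>nbrs m c k v. card S = s \<and> P (insert v S)"
    using H(2) V by metis
next
  assume "\<exists>v<m. \<exists>S\<subseteq>nbrs m c k v. card S = s \<and> P (insert v S)"
  then obtain v S where v: "v < m" and S: "S \<subseteq> nbrs m c k v" "card S = s"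
    and P: "P (insert v S)"
    by blast
  have fin: "finite S"
    using S(1) finite_nbrs finite_subset by blast
  obtain h where h: "bij_betw h {1..s} S"
    using ex_bij_betw_nat_finite_1[OF fin] S(2) by auto
  define f where "f = h(0 := v)"
  have vS: "v \<notin> S"
    using S(1) by (auto simp: nbrs_def)
  have fS: "f ` {1..s} = S"
    using h by (auto simp: f_def bij_betw_def)
  have "bij_betw f (insert 0 {1..s}) (insert v S)"
  proof -
    have "inj_on f {1..s}"
      using h inj_on_cong[of "{1..s}" h f] by (simp add: f_def bij_betw_def)
    then have "bij_betw f {1..s} S"
      using fS by (simp add: bij_betw_def)
    then show ?thesis
      using vS notIn_Un_bij_betw[of 0 "{1..s}" f S] by (simp add: f_def)
  qed
  moreover have "insert 0 {1..s} = {0..s}"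
    by auto
  ultimately have bij: "bij_betw f {0..s} (insert v S)"
    by simp
  define H where "H = (insert v S, (\<lambda>w. {v, w}) ` S)"
  have "(\<lambda>e. f ` e) ` {{0, i} |i. i \<in> {1..s}} = (\<lambda>i. f ` {0, i}) ` {1..s}"
    by blast
  also have "\<dots> = (\<lambda>w. {v, w}) ` f ` {1..s}"
    by (auto simp: f_def image_image)
  finally have "isomorphic (star s) H"
    using bij unfolding isomorphic_def star_def H_def fS by (intro exI[of _ f]) simp
  moreover have "subgraph H (color_graph m c k)"
    using S v fin vS
    by (auto simp: subgraph_def simple_graph_def H_def color_graph_def nsets_def nbrs_def
        card_insert_if)
  ultimately show "\<exists>H. subgraph H (color_graph m c k) \<and> P (verts H) \<and> isomorphic (star s) H"
    using P by (intro exI[of _ H]) (simp add: H_def)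
qed

lemma degree_eq_color_irrelevant:
  assumes "u < m" "v < m"
  shows "degree (color_graph m c k) u = degree (color_graph m c k) v \<longleftrightarrow>
         degree (color_graph m c True) u = degree (color_graph m c True) v"
  using card_nbrs_add[OF assms(1), of c] card_nbrs_add[OF assms(2), of c] assms
  by (cases k) (auto simp: degree_color_graph)

text \<open>
  A degree-constant set of leaves lies in the class of the centre, and a set of leaves with pairwise
  distinct degrees, all different from that of the centre, is a choice of representatives of other
  classes. The classes are given as the fibres of an arbitrary \<open>g\<close>, which is the red degree in
  the upper bound and the name of a part of the construction in the lower bound.
\<close>

lemma singular_star_iff:
  assumes g: "\<And>u v. u < m \<Longrightarrow> v < m \<Longrightarrow>
    degree (color_graph m c True) u = degree (color_graph m c True) v \<longleftrightarrow> g u = g v"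
    and s: "s \<ge> 1"
  shows "(\<exists>H. subgraph H (color_graph m c k) \<and> singular H (color_graph m c k) \<and>
            isomorphic (star s) H) \<longleftrightarrow>
         (\<exists>v<m. s \<le> card {w \<in> nbrs m c k v. g w = g v} \<or>
                s \<le> card (g ` {w \<in> nbrs m c k v. g w \<noteq> g v}))" (is "?L \<longleftrightarrow> ?R")
proof -
  let ?F = "color_graph m c k"
  let ?P = "\<lambda>X. (\<forall>u\<in>X. \<forall>v\<in>X. degree ?F u = degree ?F v) \<or> inj_on (degree ?F) X"
  have eq: "degree ?F u = degree ?F v \<longleftrightarrow> g u = g v" if "u < m" "v < m" for u v
    using g[OF that] degree_eq_color_irrelevant[OF that] by metis
  have P: "?P (insert v S) \<longleftrightarrow> (\<forall>w\<in>S. g w = g v) \<or> inj_on g (insert v S)"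
    if "v < m" "S \<subseteq> nbrs m c k v" for v S
  proof -
    have "\<forall>u\<in>insert v S. u < m"
      using that by (auto simp: nbrs_def)
    then have "degree ?F u = degree ?F w \<longleftrightarrow> g u = g w" if "u \<in> insert v S" "w \<in> insert v S" for u w
      using eq that by blast
    then have "(\<forall>u\<in>insert v S. \<forall>w\<in>insert v S. degree ?F u = degree ?F w) \<longleftrightarrow>
               (\<forall>u\<in>insert v S. \<forall>w\<in>insert v S. g u = g w)"
      and "inj_on (degree ?F) (insert v S) \<longleftrightarrow> inj_on g (insert v S)"
      by (simp_all add: inj_on_def cong: ball_cong)
    moreover have "(\<forall>u\<in>insert v S. \<forall>w\<in>insert v S. g u = g w) \<longleftrightarrow> (\<forall>w\<in>S. g w = g v)"
      by (metis insert_iff)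
    ultimately show ?thesis
      by (simp only:)
  qed
  have "?L \<longleftrightarrow> (\<exists>v<m. \<exists>S\<subseteq>nbrs m c k v. card S = s \<and> ?P (insert v S))"
    unfolding singular_def by (rule star_in_color_graph_iff)
  also have "\<dots> \<longleftrightarrow> (\<exists>v<m. \<exists>S\<subseteq>nbrs m c k v. card S = s \<and>
                      ((\<forall>w\<in>S. g w = g v) \<or> inj_on g (insert v S)))"
    by (intro ex_cong1 conj_cong refl P)
  also have "\<dots> \<longleftrightarrow> ?R"
  proof (intro ex_cong1 conj_cong refl iffI)
    fix v assume "\<exists>S\<subseteq>nbrs m c k v. card S = s \<and> ((\<forall>w\<in>S. g w = g v) \<or> inj_on g (insert v S))"
    then obtain S where S: "S \<subseteq> nbrs m c k v" "card S = s"
      and "(\<forall>w\<in>S. g w = g v) \<or> inj_on g (insert v S)"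
      by blast
    then show "s \<le> card {w \<in> nbrs m c k v. g w = g v} \<or>
               s \<le> card (g ` {w \<in> nbrs m c k v. g w \<noteq> g v})"
    proof (elim disjE)
      assume "\<forall>w\<in>S. g w = g v"
      then have "S \<subseteq> {w \<in> nbrs m c k v. g w = g v}"
        using S by auto
      then show ?thesis
        using card_mono[of "{w \<in> nbrs m c k v. g w = g v}" S] S(2) by simp
    next
      assume inj: "inj_on g (insert v S)"
      then have "g ` S \<subseteq> g ` {w \<in> nbrs m c k v. g w \<noteq> g v}"
      proof (intro image_mono subsetI CollectI conjI)
        fix w assume w: "w \<in> S"
        then show "w \<in> nbrs m c k v"
          using S(1) by blast
        then have "w \<noteq> v"
          by (simp add: nbrs_def)
        then show "g w \<noteq> g v"
          using inj w by (auto simp del: inj_on_insert simp: inj_on_eq_iff)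
      qed
      moreover have "card (g ` S) = s"
        using inj S(2) by (auto simp: card_image)
      ultimately show ?thesis
        using card_mono[of "g ` {w \<in> nbrs m c k v. g w \<noteq> g v}" "g ` S"] by simp
    qed
  next
    fix v assume "s \<le> card {w \<in> nbrs m c k v. g w = g v} \<or>
                  s \<le> card (g ` {w \<in> nbrs m c k v. g w \<noteq> g v})"
    then show "\<exists>S\<subseteq>nbrs m c k v. card S = s \<and> ((\<forall>w\<in>S. g w = g v) \<or> inj_on g (insert v S))"
    proof
      assume "s \<le> card {w \<in> nbrs m c k v. g w = g v}"
      then obtain S where "S \<subseteq> {w \<in> nbrs m c k v. g w = g v}" "card S = s"
        by (meson obtain_subset_with_card_n)
      then show ?thesis
        by (intro exI[of _ S]) auto
    next
      assume "s \<le> card (g ` {w \<in> nbrs m c k v. g w \<noteq> g v})"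
      then obtain T where T: "T \<subseteq> g ` {w \<in> nbrs m c k v. g w \<noteq> g v}" "card T = s"
        by (meson obtain_subset_with_card_n)
      then obtain S where S: "S \<subseteq> {w \<in> nbrs m c k v. g w \<noteq> g v}" "inj_on g S" "T = g ` S"
        by (meson subset_image_inj)
      then have "card S = s" "inj_on g (insert v S)"
        using T(2) by (auto simp: card_image)
      then show ?thesis
        using S by (intro exI[of _ S]) auto
    qed
  qed
  finally show ?thesis .
qed

section \<open>The upper bound\<close>

lemma card_le_card_image_times:
  assumes "finite A" and "\<And>y. y \<in> f ` A \<Longrightarrow> card {x \<in> A. f x = y} \<le> n"
  shows "card A \<le> card (f ` A) * n"
proof -
  have "A = (\<Union>y\<in>f ` A. {x \<in> A. f x = y})"
    by auto
  then have "card A \<le> (\<Sum>y\<in>f ` A. card {x \<in> A. f x = y})"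
    using card_UN_le[of "f ` A" "\<lambda>y. {x \<in> A. f x = y}"] assms(1) by simp
  also have "\<dots> \<le> card (f ` A) * n"
    using sum_bounded_above[of "f ` A" "\<lambda>y. card {x \<in> A. f x = y}" n] assms(2) by simp
  finally show ?thesis .
qed

text \<open>
  Counting degrees by the window argument: large \<open>m\<close> leaves too few values for the red degree, hence
  too few classes to accommodate all vertices.
\<close>

lemma singular_star_exists:
  assumes s: "s \<ge> 1" and m: "m \<ge> (2 * s - 1) * (2 * s - 2) + 2"
  shows "\<exists>k H. subgraph H (color_graph m c k) \<and> singular H (color_graph m c k) \<and>
               isomorphic (star s) H"
proof (rule ccontr)
  assume neg: "\<not> ?thesis"
  define d where "d = degree (color_graph m c True)"
  obtain t where t: "s = Suc t"
    using s by (cases s) auto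
  have none: "card {w \<in> nbrs m c k v. d w = d v} \<le> t \<and> card (d ` {w \<in> nbrs m c k v. d w \<noteq> d v}) \<le> t"
    if "v < m" for v k
  proof -
    have "\<not> (\<exists>H. subgraph H (color_graph m c k) \<and> singular H (color_graph m c k) \<and>
               isomorphic (star s) H)"
      using neg by blast
    then have "\<not> (s \<le> card {w \<in> nbrs m c k v. d w = d v} \<or>
                 s \<le> card (d ` {w \<in> nbrs m c k v. d w \<noteq> d v}))"
      using that by (subst (asm) singular_star_iff[where g = d]) (auto simp: d_def t)
    then show ?thesis
      by (simp add: t not_le)
  qed
  have cls: "card {w. w < m \<and> d w = d v} \<le> 2 * t + 1" if "v < m" for v
  proof -
    have "{w. w < m \<and> d w = d v} = insert v ({w \<in> nbrs m c True v. d w = d v} \<union>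
            {w \<in> nbrs m c False v. d w = d v})"
      using that by (auto simp: nbrs_def)
    then have "card {w. w < m \<and> d w = d v} \<le> Suc (card ({w \<in> nbrs m c True v. d w = d v} \<union>
            {w \<in> nbrs m c False v. d w = d v}))"
      by (simp add: card_insert_le_m1 card_insert_if)
    also have "\<dots> \<le> Suc (t + t)"
      using card_Un_le[of "{w \<in> nbrs m c True v. d w = d v}" "{w \<in> nbrs m c False v. d w = d v}"]
        none[OF that, of True] none[OF that, of False] by linarith
    finally show ?thesis
      by simp
  qed
  have nb: "card (nbrs m c k v) \<le> t + t * (2 * t + 1)" if v: "v < m" for v k
  proof -
    let ?A = "{w \<in> nbrs m c k v. d w \<noteq> d v}"
    have "card ?A \<le> card (d ` ?A) * (2 * t + 1)"
    proof (rule card_le_card_image_times)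
      fix y assume "y \<in> d ` ?A"
      then obtain u where u: "u \<in> nbrs m c k v" "y = d u"
        by auto
      then have "u < m"
        by (simp add: nbrs_def)
      have "card {x \<in> ?A. d x = y} \<le> card {w. w < m \<and> d w = d u}"
        using u by (intro card_mono) (auto simp: nbrs_def)
      then show "card {x \<in> ?A. d x = y} \<le> 2 * t + 1"
        using cls[OF \<open>u < m\<close>] by linarith
    qed simp
    also have "\<dots> \<le> t * (2 * t + 1)"
      using none[OF v, of k] by (intro mult_right_mono) auto
    finally have "card ?A \<le> t * (2 * t + 1)" .
    moreover have "nbrs m c k v = {w \<in> nbrs m c k v. d w = d v} \<union> ?A"
      by auto
    then have "card (nbrs m c k v) \<le> card {w \<in> nbrs m c k v. d w = d v} + card ?A"
      by (metis card_Un_le)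
    ultimately show ?thesis
      using none[OF v, of k] by linarith
  qed
  \<comment> \<open>Bounding the blue degree by \<open>?D\<close> bounds the red degree from below.\<close>
  let ?D = "t + t * (2 * t + 1)"
  have "d ` {..<m} \<subseteq> {m - 1 - ?D..?D}"
  proof
    fix y assume "y \<in> d ` {..<m}"
    then obtain v where v: "v < m" "y = card (nbrs m c True v)"
      by (auto simp: d_def degree_color_graph)
    then show "y \<in> {m - 1 - ?D..?D}"
      using nb[OF v(1), of True] nb[OF v(1), of False] card_nbrs_add[OF v(1), of c] by auto
  qed
  then have "card (d ` {..<m}) \<le> ?D + 1 - (m - 1 - ?D)"
    using card_mono[of "{m - 1 - ?D..?D}" "d ` {..<m}"] by simp
  also have "\<dots> \<le> 2 * t"
    using m by (simp add: t algebra_simps)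
  finally have "card (d ` {..<m}) \<le> 2 * t" .
  then have "card (d ` {..<m}) * (2 * t + 1) \<le> 2 * t * (2 * t + 1)"
    by (rule mult_right_mono) simp
  moreover have "m \<le> card (d ` {..<m}) * (2 * t + 1)"
  proof -
    have "card {x \<in> {..<m}. d x = y} \<le> 2 * t + 1" if "y \<in> d ` {..<m}" for y
      using that cls by auto
    then show ?thesis
      using card_le_card_image_times[of "{..<m}" d "2 * t + 1"] by simp
  qed
  ultimately show False
    using m by (simp add: t algebra_simps)
qed

section \<open>Regular graphs\<close>

text \<open>
  On the vertices \<open>0, \<dots>, 4r\<close> this is the circulant graph that joins vertices at cyclic distance at
  most \<open>r\<close>, written with ordinary instead of cyclic distances. Degree \<open>2r\<close> is exactly half of the
  \<open>4r\<close> other vertices.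
\<close>

definition circ :: "nat \<Rightarrow> nat \<Rightarrow> nat \<Rightarrow> bool" where
  "circ r a b \<longleftrightarrow> (b \<le> a + r \<and> a \<le> b + r) \<or> a + 3 * r < b \<or> b + 3 * r < a"

lemma circ_commute: "circ r a b = circ r b a"
  by (auto simp: circ_def)

lemma card_circ:
  assumes "a < 4 * r + 1"
  shows "card {b. b < 4 * r + 1 \<and> b \<noteq> a \<and> circ r a b} = 2 * r"
proof -
  consider "a < r" | "r \<le> a" "a \<le> 3 * r" | "3 * r < a"
    by linarith
  then show ?thesis
  proof cases
    case 1
    then have "{b. b < 4 * r + 1 \<and> b \<noteq> a \<and> circ r a b} =
        ({..a + r} - {a}) \<union> {a + 3 * r + 1..4 * r}"
      by (auto simp: circ_def)
    moreover have "card \<dots> = card ({..a + r} - {a}) + card {a + 3 * r + 1..4 * r}"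
      using 1 by (intro card_Un_disjoint) auto
    ultimately show ?thesis
      using 1 by simp
  next
    case 2
    then have "{b. b < 4 * r + 1 \<and> b \<noteq> a \<and> circ r a b} = {a - r..a + r} - {a}"
      by (auto simp: circ_def)
    then show ?thesis
      using 2 by simp
  next
    case 3
    then have "{b. b < 4 * r + 1 \<and> b \<noteq> a \<and> circ r a b} =
        ({a - r..4 * r} - {a}) \<union> {..<a - 3 * r}"
      using assms by (auto simp: circ_def)
    moreover have "card \<dots> = card ({a - r..4 * r} - {a}) + card {..<a - 3 * r}"
      using 3 by (intro card_Un_disjoint) auto
    ultimately show ?thesis
      using 3 assms by simp
  qed
qed

lemma card_even_less: "card {b. b < 2 * q \<and> even b} = q"
proof -
  have "{b. b < 2 * q \<and> even b} = (\<lambda>i. 2 * i) ` {..<q}"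
    by (auto elim!: evenE)
  then show ?thesis
    by (simp add: card_image inj_on_def)
qed

lemma card_odd_less: "card {b. b < 2 * q \<and> odd b} = q"
proof -
  have "{b. b < 2 * q \<and> odd b} = (\<lambda>i. 2 * i + 1) ` {..<q}"
    by (auto elim!: oddE)
  then show ?thesis
    by (simp add: card_image inj_on_def)
qed

lemma card_other_parity:
  "card {b. b < 2 * q \<and> b \<noteq> a \<and> odd (a + b)} = q"
proof -
  have "{b. b < 2 * q \<and> b \<noteq> a \<and> odd (a + b)} =
        (if even a then {b. b < 2 * q \<and> odd b} else {b. b < 2 * q \<and> even b})"
    by auto
  then show ?thesis
    by (simp add: card_even_less card_odd_less)
qed

lemma card_same_parity:
  assumes "a < 2 * q"
  shows "card {b. b < 2 * q \<and> b \<noteq> a \<and> even (a + b)} = q - 1"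
proof -
  have "{b. b < 2 * q \<and> b \<noteq> a \<and> even (a + b)} =
        (if even a then {b. b < 2 * q \<and> even b} else {b. b < 2 * q \<and> odd b}) - {a}"
    by auto
  then show ?thesis
    using assms by (simp add: card_even_less card_odd_less)
qed


section \<open>The lower bound\<close>

text \<open>
  Transports a relation on an arbitrary finite vertex set to a colouring of a complete graph on
  natural numbers, so that the construction can use structured vertices.
\<close>

lemma coloring_without_singular_star:
  fixes R :: "'a \<Rightarrow> 'a \<Rightarrow> bool" and g :: "'a \<Rightarrow> 'b"
  assumes fin: "finite V" and s: "s \<ge> 1" and sym: "\<And>v w. R v w = R w v"
    and deg: "\<And>v w. v \<in> V \<Longrightarrow> w \<in> V \<Longrightarrow>
      card {x \<in> V. x \<noteq> v \<and> R v x} = card {x \<in> V. x \<noteq> w \<and> R w x} \<longleftrightarrow> g v = g w"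
    and own: "\<And>v k. v \<in> V \<Longrightarrow> card {w \<in> V. w \<noteq> v \<and> R v w = k \<and> g w = g v} < s"
    and other: "\<And>v k. v \<in> V \<Longrightarrow> card (g ` {w \<in> V. w \<noteq> v \<and> R v w = k \<and> g w \<noteq> g v}) < s"
  shows "\<exists>c. \<not> (\<exists>k H. subgraph H (color_graph (card V) c k) \<and>
                    singular H (color_graph (card V) c k) \<and> isomorphic (star s) H)"
proof -
  let ?m = "card V"
  obtain f where f: "bij_betw f {..<?m} V"
    using ex_bij_betw_nat_finite[OF fin] by (auto simp: atLeast0LessThan)
  define c where "c e \<longleftrightarrow> (\<exists>a b. e = {a, b} \<and> R (f a) (f b))" for e
  have c: "c {a, b} \<longleftrightarrow> R (f a) (f b)" for a b
    unfolding c_def doubleton_eq_iff using sym by blast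
  have fV: "f v \<in> V" if "v < ?m" for v
    using f that by (auto simp: bij_betw_def)
  have img: "f ` {w \<in> nbrs ?m c k v. P (f w)} = {x \<in> V. x \<noteq> f v \<and> R (f v) x = k \<and> P x}"
    if v: "v < ?m" for v k P
  proof (intro equalityI subsetI)
    fix x assume "x \<in> f ` {w \<in> nbrs ?m c k v. P (f w)}"
    then obtain w where "w < ?m" "w \<noteq> v" "c {v, w} = k" "P (f w)" "x = f w"
      by (auto simp: nbrs_def)
    moreover have "f w \<noteq> f v"
      using f v \<open>w < ?m\<close> \<open>w \<noteq> v\<close> by (auto simp: bij_betw_def inj_on_def)
    ultimately show "x \<in> {x \<in> V. x \<noteq> f v \<and> R (f v) x = k \<and> P x}"
      using c fV by auto
  next
    fix x assume x: "x \<in> {x \<in> V. x \<noteq> f v \<and> R (f v) x = k \<and> P x}"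
    then obtain w where "w < ?m" "x = f w"
      using f by (auto simp: bij_betw_def)
    then show "x \<in> f ` {w \<in> nbrs ?m c k v. P (f w)}"
      using x by (auto simp: nbrs_def c)
  qed
  have inj: "inj_on f {w \<in> nbrs ?m c k v. P (f w)}" for v k P
    using f by (auto simp: bij_betw_def nbrs_def intro: inj_on_subset)
  have card_img: "card {w \<in> nbrs ?m c k v. P (f w)} = card {x \<in> V. x \<noteq> f v \<and> R (f v) x = k \<and> P x}"
    if "v < ?m" for v k P
    using img[OF that] card_image[OF inj] by metis
  have "degree (color_graph ?m c True) v = card {x \<in> V. x \<noteq> f v \<and> R (f v) x}" if "v < ?m" for v
    using card_img[OF that, of True "\<lambda>_. True"] that by (simp add: degree_color_graph)
  then have iff: "degree (color_graph ?m c True) u = degree (color_graph ?m c True) v \<longleftrightarrow>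
                 g (f u) = g (f v)" if "u < ?m" "v < ?m" for u v
    using that deg fV by simp
  have "\<not> (\<exists>H. subgraph H (color_graph ?m c k) \<and> singular H (color_graph ?m c k) \<and>
               isomorphic (star s) H)" for k
  proof -
    have own': "card {w \<in> nbrs ?m c k v. g (f w) = g (f v)} < s" if "v < ?m" for v
      using card_img[OF that, of k "\<lambda>x. g x = g (f v)"] own[OF fV[OF that]] by simp
    have other': "card ((\<lambda>w. g (f w)) ` {w \<in> nbrs ?m c k v. g (f w) \<noteq> g (f v)}) < s"
      if "v < ?m" for v
    proof -
      have "(\<lambda>w. g (f w)) ` {w \<in> nbrs ?m c k v. g (f w) \<noteq> g (f v)} =
          g ` {x \<in> V. x \<noteq> f v \<and> R (f v) x = k \<and> g x \<noteq> g (f v)}"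
        unfolding img[OF that, of k "\<lambda>x. g x \<noteq> g (f v)", symmetric] image_image ..
      then show ?thesis
        using other[OF fV[OF that], of k] by (simp only:)
    qed
    have "\<not> (\<exists>v<?m. s \<le> card {w \<in> nbrs ?m c k v. g (f w) = g (f v)} \<or>
        s \<le> card ((\<lambda>w. g (f w)) ` {w \<in> nbrs ?m c k v. g (f w) \<noteq> g (f v)}))"
      using own' other' by (meson not_le)
    moreover have "(\<exists>H. subgraph H (color_graph ?m c k) \<and> singular H (color_graph ?m c k) \<and>
          isomorphic (star s) H) \<longleftrightarrow>
        (\<exists>v<?m. s \<le> card {w \<in> nbrs ?m c k v. g (f w) = g (f v)} \<or>
          s \<le> card ((\<lambda>w. g (f w)) ` {w \<in> nbrs ?m c k v. g (f w) \<noteq> g (f v)}))"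
      by (rule singular_star_iff[OF iff s])
    ultimately show ?thesis
      by (simp only: not_False_eq_True)
  qed
  then show ?thesis
    by blast
qed

text \<open>
  The classes of the construction for \<open>s = 2r + 1\<close>. Of the \<open>4r + 1\<close> vertices that a class may have, none
  is missing in a class \<open>Full j\<close> (\<open>0 \<le> j \<le> 2r\<close>), one is missing in a class \<open>Light i\<close> (\<open>1 \<le> i < 2r\<close>), and
  \<open>2r + 1\<close> are missing in the class \<open>Hub\<close>. For \<open>r \<ge> 1\<close> this makes \<open>4r\<close> missing vertices in total.
\<close>

datatype cls = Hub | Light nat | Full nat

definition classes :: "nat \<Rightarrow> cls set" where
  "classes r = {Hub} \<union> Light ` {1..<2 * r} \<union> Full ` {..2 * r}"

fun class_size :: "nat \<Rightarrow> cls \<Rightarrow> nat" where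
  "class_size r Hub = 2 * r"
| "class_size r (Light i) = 4 * r"
| "class_size r (Full j) = 4 * r + 1"

text \<open>
  Which pairs of classes are joined in red. The \<open>Light\<close> classes form a threshold graph, the \<open>Full\<close>
  classes another one, and a half graph lies between them. Along the half graph, the number of \<open>Light\<close>
  neighbours of \<open>Full j\<close> grows with \<open>j\<close> while the number of its \<open>Full\<close> neighbours shrinks, and similarly
  for \<open>Light i\<close>, so that the number of missing vertices in the neighbouring classes
  varies although the graph is regular.

  Without \<open>Hub\<close>, the drop in degree would be \<open>i\<close> for \<open>Light i\<close>, \<open>j - 1\<close> for \<open>Full j\<close> with \<open>j \<ge> 1\<close>, and
  \<open>0\<close> for \<open>Full 0\<close>, given the graphs chosen inside the classes below. Thus \<open>Light i\<close> would
  coincide with \<open>Full (i + 1)\<close>, and \<open>Full 0\<close> with \<open>Full 1\<close>. The class \<open>Hub\<close> is joined to exactly one class of each of these \<open>2r\<close> pairs, whose drop it raises by \<open>2r + 1\<close>,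
  beyond all the others; the gap at \<open>2r\<close> is filled by \<open>Hub\<close> itself. The
  choice within the pairs is the one that makes the graph regular: \<open>Hub\<close> is joined precisely to those classes that lose a neighbour because the threshold condition
  also holds for the class paired with itself, except that \<open>Full 0\<close> needs no compensation.
\<close>

fun class_adj :: "nat \<Rightarrow> cls \<Rightarrow> cls \<Rightarrow> bool" where
  "class_adj r Hub Hub = False"
| "class_adj r Hub (Light i) = (r \<le> i)"
| "class_adj r (Light i) Hub = (r \<le> i)"
| "class_adj r Hub (Full j) = (1 \<le> j \<and> j \<le> r)"
| "class_adj r (Full j) Hub = (1 \<le> j \<and> j \<le> r)"
| "class_adj r (Light i) (Light k) = (2 * r \<le> i + k)"
| "class_adj r (Light i) (Full j) = (i < j)"
| "class_adj r (Full j) (Light i) = (i < j)"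
| "class_adj r (Full j) (Full k) = (j + k \<le> 2 * r)"

text \<open>
  The red graphs inside the classes: a complete bipartite graph given by parity, two disjoint cliques,
  or the circulant graph. Replacing the bipartite graph by the two cliques lowers the degree by
  one. This happens for \<open>i \<ge> r\<close>, where \<open>Light i\<close> satisfies the threshold condition with itself and hence
  has only \<open>i - 1\<close> neighbours among the other \<open>Light\<close> classes; the lower degree makes its drop without
  \<open>Hub\<close> equal to \<open>i\<close> again.
\<close>

fun inner_adj :: "nat \<Rightarrow> cls \<Rightarrow> nat \<Rightarrow> nat \<Rightarrow> bool" where
  "inner_adj r Hub a b = odd (a + b)"
| "inner_adj r (Light i) a b = (if i < r then odd (a + b) else even (a + b))"
| "inner_adj r (Full j) a b = circ r a b"

text \<open>
  The drop of the red degree below \<open>2r + 2r(4r + 1)\<close>. On nonempty classes it is injective.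
\<close>

fun degree_drop :: "nat \<Rightarrow> cls \<Rightarrow> nat" where
  "degree_drop r Hub = 2 * r"
| "degree_drop r (Light i) = (if i < r then i else 2 * r + 1 + i)"
| "degree_drop r (Full j) = (if 1 \<le> j \<and> j \<le> r then 2 * r + j else j - 1)"

definition red :: "nat \<Rightarrow> cls \<times> nat \<Rightarrow> cls \<times> nat \<Rightarrow> bool" where
  "red r v w \<longleftrightarrow> (if fst v = fst w then inner_adj r (fst v) (snd v) (snd w)
                 else class_adj r (fst v) (fst w))"

definition blow_up :: "nat \<Rightarrow> (cls \<times> nat) set" where
  "blow_up r = (SIGMA c:classes r. {..<class_size r c})"

lemma finite_classes [simp]: "finite (classes r)"
  by (simp add: classes_def)

lemma finite_blow_up [simp]: "finite (blow_up r)"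
  by (simp add: blow_up_def)

lemma class_adj_commute: "class_adj r c d = class_adj r d c"
  by (cases c; cases d) (simp_all add: add.commute)

lemma inner_adj_commute: "inner_adj r c a b = inner_adj r c b a"
  by (cases c) (simp_all add: add.commute[of a b] circ_commute[of r a b])

lemma red_commute: "red r v w = red r w v"
  unfolding red_def using class_adj_commute inner_adj_commute by (metis (full_types))

lemma sum_classes:
  fixes f :: "cls \<Rightarrow> nat"
  shows "(\<Sum>d | d \<in> classes r \<and> P d. f d) =
    (if P Hub then f Hub else 0) + (\<Sum>i | i \<in> {1..<2 * r} \<and> P (Light i). f (Light i)) +
    (\<Sum>j | j \<le> 2 * r \<and> P (Full j). f (Full j))"
proof -
  have "{d. d \<in> classes r \<and> P d} = (if P Hub then {Hub} else {}) \<union>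
      Light ` {i. i \<in> {1..<2 * r} \<and> P (Light i)} \<union> Full ` {j. j \<le> 2 * r \<and> P (Full j)}"
    by (auto simp: classes_def)
  moreover have "sum f \<dots> = sum f (if P Hub then {Hub} else {}) +
      sum f (Light ` {i. i \<in> {1..<2 * r} \<and> P (Light i)}) +
      sum f (Full ` {j. j \<le> 2 * r \<and> P (Full j)})"
    by (subst sum.union_disjoint; (subst sum.union_disjoint)?) auto
  moreover have "sum f (Light ` {i. i \<in> {1..<2 * r} \<and> P (Light i)}) =
      (\<Sum>i | i \<in> {1..<2 * r} \<and> P (Light i). f (Light i))"
    by (subst sum.reindex) (auto simp: inj_on_def)
  moreover have "sum f (Full ` {j. j \<le> 2 * r \<and> P (Full j)}) =
      (\<Sum>j | j \<le> 2 * r \<and> P (Full j). f (Full j))"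
    by (subst sum.reindex) (auto simp: inj_on_def)
  ultimately show ?thesis
    by simp
qed

lemma card_blow_up: "card (blow_up r) = 4 * r * (4 * r + 1) + 1"
proof -
  have "card (blow_up r) = (\<Sum>d | d \<in> classes r \<and> True. class_size r d)"
    by (simp add: blow_up_def)
  also have "\<dots> = 2 * r + (2 * r - 1) * (4 * r) + (2 * r + 1) * (4 * r + 1)"
    unfolding sum_classes by (simp add: atMost_def[symmetric] del: atLeastLessThan_iff)
  also have "\<dots> = 4 * r * (4 * r + 1) + 1"
    by (cases r) (simp_all add: algebra_simps)
  finally show ?thesis .
qed

definition light_nbrs :: "nat \<Rightarrow> cls \<Rightarrow> nat" where
  "light_nbrs r c = card {i. i \<in> {1..<2 * r} \<and> Light i \<noteq> c \<and> class_adj r c (Light i)}"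

definition full_nbrs :: "nat \<Rightarrow> cls \<Rightarrow> nat" where
  "full_nbrs r c = card {j. j \<le> 2 * r \<and> Full j \<noteq> c \<and> class_adj r c (Full j)}"

lemma light_nbrs_simps:
  "light_nbrs r Hub = r"
  "k \<in> {1..<2 * r} \<Longrightarrow> light_nbrs r (Light k) = (if k < r then k else k - 1)"
  "k \<le> 2 * r \<Longrightarrow> light_nbrs r (Full k) = k - 1"
proof -
  have "{i. i \<in> {1..<2 * r} \<and> r \<le> i} = {r..<2 * r}"
    by auto
  then show "light_nbrs r Hub = r"
    by (simp add: light_nbrs_def)
next
  assume k: "k \<in> {1..<2 * r}"
  then have "{i. i \<in> {1..<2 * r} \<and> i \<noteq> k \<and> 2 * r \<le> k + i} = {2 * r - k..<2 * r} - {k}"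
    by auto
  then show "light_nbrs r (Light k) = (if k < r then k else k - 1)"
    using k by (auto simp: light_nbrs_def)
next
  assume "k \<le> 2 * r"
  then have "{i. i \<in> {1..<2 * r} \<and> i < k} = {1..<k}"
    by auto
  then show "light_nbrs r (Full k) = k - 1"
    by (simp add: light_nbrs_def)
qed

lemma full_nbrs_simps:
  "full_nbrs r Hub = r"
  "full_nbrs r (Light k) = 2 * r - k"
  "k \<le> 2 * r \<Longrightarrow> full_nbrs r (Full k) = (if k \<le> r then 2 * r - k else 2 * r + 1 - k)"
proof -
  have "{j. j \<le> 2 * r \<and> Suc 0 \<le> j \<and> j \<le> r} = {1..r}"
    by auto
  then show "full_nbrs r Hub = r"
    by (simp add: full_nbrs_def)
next
  have "{j. j \<le> 2 * r \<and> k < j} = {k<..2 * r}"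
    by auto
  then show "full_nbrs r (Light k) = 2 * r - k"
    by (simp add: full_nbrs_def)
next
  assume k: "k \<le> 2 * r"
  then have "{j. j \<le> 2 * r \<and> j \<noteq> k \<and> k + j \<le> 2 * r} = {..2 * r - k} - {k}"
    by auto
  then have "full_nbrs r (Full k) = card ({..2 * r - k} - {k})"
    by (simp add: full_nbrs_def)
  then show "full_nbrs r (Full k) = (if k \<le> r then 2 * r - k else 2 * r + 1 - k)"
    using k by (simp add: card_Diff_singleton_if) linarith
qed

text \<open>
  With \<open>f\<close> constant this counts neighbouring classes, with \<open>f\<close> the identity it counts their vertices.
\<close>

lemma sum_adjacent_classes:
  "(\<Sum>d | d \<in> classes r \<and> d \<noteq> c \<and> class_adj r c d. f (class_size r d)) =
   (if class_adj r c Hub then f (2 * r) else 0) + light_nbrs r c * f (4 * r) +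
   full_nbrs r c * f (4 * r + 1)"
proof -
  have "Hub \<noteq> c \<and> class_adj r c Hub \<longleftrightarrow> class_adj r c Hub"
    by (cases c) auto
  then show ?thesis
    unfolding sum_classes by (simp add: light_nbrs_def full_nbrs_def)
qed

lemma class_adj_regular:
  assumes "c \<in> classes r"
  shows "card {d. d \<in> classes r \<and> d \<noteq> c \<and> class_adj r c d} = 2 * r"
proof -
  have "card {d. d \<in> classes r \<and> d \<noteq> c \<and> class_adj r c d} =
      (if class_adj r c Hub then 1 else 0) + light_nbrs r c + full_nbrs r c"
    using sum_adjacent_classes[where r = r and c = c and f = "\<lambda>_. 1"] by simp
  also have "\<dots> = 2 * r"
    using assms by (auto simp: classes_def light_nbrs_simps full_nbrs_simps)
  finally show ?thesis .
qed

lemma card_classes: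
  assumes "r > 0"
  shows "card (classes r) = 4 * r + 1"
proof -
  have "card (classes r) = (\<Sum>d | d \<in> classes r \<and> True. 1)"
    by simp
  also have "\<dots> = 1 + (2 * r - 1) + (2 * r + 1)"
    unfolding sum_classes by (simp add: atMost_def[symmetric] del: atLeastLessThan_iff)
  finally show ?thesis
    using assms by simp
qed

lemma card_not_adjacent_classes:
  assumes "c \<in> classes r" "r > 0"
  shows "card {d. d \<in> classes r \<and> d \<noteq> c \<and> \<not> class_adj r c d} = 2 * r"
proof -
  have "{d. d \<in> classes r \<and> d \<noteq> c \<and> \<not> class_adj r c d} =
      classes r - {c} - {d. d \<in> classes r \<and> d \<noteq> c \<and> class_adj r c d}"
    by auto
  moreover have "card \<dots> = card (classes r - {c}) - card {d. d \<in> classes r \<and> d \<noteq> c \<and> class_adj r c d}"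
    by (rule card_Diff_subset) auto
  ultimately show ?thesis
    using assms by (simp add: class_adj_regular card_classes)
qed

definition inner_degree :: "nat \<Rightarrow> cls \<Rightarrow> nat" where
  "inner_degree r c = (case c of Hub \<Rightarrow> r | Light i \<Rightarrow> if i < r then 2 * r else 2 * r - 1
     | Full j \<Rightarrow> 2 * r)"

lemma card_inner_adj:
  assumes "a < class_size r c"
  shows "card {b. b < class_size r c \<and> b \<noteq> a \<and> inner_adj r c a b} = inner_degree r c"
proof (cases c)
  case Hub
  then show ?thesis
    using card_other_parity[of r a] by (simp add: inner_degree_def)
next
  case (Light i)
  then show ?thesis
    using card_other_parity[of "2 * r" a] card_same_parity[of a "2 * r"] assms
    by (simp add: inner_degree_def)
next
  case (Full j)
  then show ?thesis
    using card_circ[of a r] assms by (simp add: inner_degree_def)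
qed

lemma card_inner_not_adj:
  assumes "a < class_size r c"
  shows "card {b. b < class_size r c \<and> b \<noteq> a \<and> \<not> inner_adj r c a b} \<le> 2 * r"
proof -
  have "{b. b < class_size r c \<and> b \<noteq> a \<and> \<not> inner_adj r c a b} =
      {..<class_size r c} - {a} - {b. b < class_size r c \<and> b \<noteq> a \<and> inner_adj r c a b}"
    by auto
  moreover have "card \<dots> = card ({..<class_size r c} - {a}) -
      card {b. b < class_size r c \<and> b \<noteq> a \<and> inner_adj r c a b}"
    by (rule card_Diff_subset) auto
  ultimately have "card {b. b < class_size r c \<and> b \<noteq> a \<and> \<not> inner_adj r c a b} =
      class_size r c - 1 - inner_degree r c"
    using assms by (simp only: card_inner_adj card_Diff_singleton lessThan_iff card_lessThan)
  also have "\<dots> \<le> 2 * r"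
    by (cases c) (auto simp: inner_degree_def)
  finally show ?thesis .
qed

text \<open>
  If the \<open>2r\<close> red neighbouring classes all had \<open>4r + 1\<close> vertices, they would contribute \<open>2r(4r + 1)\<close>
  to the degree. Each \<open>Light\<close> neighbour lowers this by \<open>1\<close> and \<open>Hub\<close> by \<open>2r + 1\<close>; together with what the
  degree inside the class lacks to \<open>2r\<close>, this loss is the drop.
\<close>

lemma card_red_add_degree_drop:
  assumes "v \<in> blow_up r"
  shows "card {w \<in> blow_up r. w \<noteq> v \<and> red r v w} + degree_drop r (fst v) = 2 * r + 2 * r * (4 * r + 1)"
proof -
  obtain c a where v: "v = (c, a)"
    by force
  have c: "c \<in> classes r" and a: "a < class_size r c"
    using assms by (auto simp: blow_up_def v)
  let ?N = "{d. d \<in> classes r \<and> d \<noteq> c \<and> class_adj r c d}"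
  have "{w \<in> blow_up r. w \<noteq> v \<and> red r v w} =
      Pair c ` {b. b < class_size r c \<and> b \<noteq> a \<and> inner_adj r c a b} \<union>
      (SIGMA d:?N. {..<class_size r d})"
    using c by (auto simp: v blow_up_def red_def)
  moreover have "card \<dots> = card (Pair c ` {b. b < class_size r c \<and> b \<noteq> a \<and> inner_adj r c a b}) +
      card (SIGMA d:?N. {..<class_size r d})"
    by (rule card_Un_disjoint) auto
  moreover have "card (Pair c ` {b. b < class_size r c \<and> b \<noteq> a \<and> inner_adj r c a b}) =
      inner_degree r c"
    by (simp add: card_image inj_on_def card_inner_adj[OF a])
  moreover have "card (SIGMA d:?N. {..<class_size r d}) = (\<Sum>d\<in>?N. class_size r d)"
    by simp
  ultimately have "card {w \<in> blow_up r. w \<noteq> v \<and> red r v w} =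
      inner_degree r c + (\<Sum>d\<in>?N. class_size r d)"
    by simp
  also have "\<dots> = inner_degree r c + ((if class_adj r c Hub then 2 * r else 0) +
      light_nbrs r c * (4 * r) + full_nbrs r c * (4 * r + 1))"
    using sum_adjacent_classes[where r = r and c = c and f = "\<lambda>x. x"] by simp
  finally have card: "card {w \<in> blow_up r. w \<noteq> v \<and> red r v w} = \<dots>" .
  \<comment> \<open>The indicator of \<open>Hub\<close> being a neighbour keeps the remaining arithmetic linear.\<close>
  define h where "h = (if class_adj r c Hub then 1 else 0 :: nat)"
  have "h + light_nbrs r c + full_nbrs r c = 2 * r"
    using class_adj_regular[OF c] sum_adjacent_classes[where r = r and c = c and f = "\<lambda>_. 1"]
    by (simp add: h_def)
  then have "(h + light_nbrs r c + full_nbrs r c) * (4 * r + 1) = 2 * r * (4 * r + 1)"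
    by simp
  then have "(if class_adj r c Hub then 2 * r else 0) + light_nbrs r c * (4 * r) +
      full_nbrs r c * (4 * r + 1) + (h * (2 * r + 1) + light_nbrs r c) = 2 * r * (4 * r + 1)"
    by (simp add: h_def algebra_simps split: if_splits)
  moreover have "inner_degree r c + degree_drop r c = 2 * r + (h * (2 * r + 1) + light_nbrs r c)"
    using c by (auto simp: h_def classes_def inner_degree_def light_nbrs_simps)
  ultimately show ?thesis
    using card by (simp only: v fst_conv)
qed

text \<open>
  Membership in the blow-up excludes the empty part \<open>Hub\<close> for \<open>r = 0\<close>, whose drop is that of \<open>Full 0\<close>.
\<close>

lemma degree_drop_inj:
  assumes "(c, a) \<in> blow_up r" "(d, b) \<in> blow_up r" "degree_drop r c = degree_drop r d"
  shows "c = d"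
  using assms by (auto simp: blow_up_def classes_def split: if_splits)

text \<open>
  By the injectivity of the drop, the degree classes are the parts of the blow-up. In each colour a
  vertex has at most \<open>2r\<close> neighbours inside its part, and its part is joined to at most \<open>2r\<close> other
  nonempty parts, so neither kind of singular star with \<open>2r + 1\<close> leaves has room.
\<close>

lemma avoiding_coloring_exists:
  "\<exists>c. \<not> (\<exists>k H. subgraph H (color_graph (4 * r * (4 * r + 1) + 1) c k) \<and>
             singular H (color_graph (4 * r * (4 * r + 1) + 1) c k) \<and>
             isomorphic (star (2 * r + 1)) H)"
  unfolding card_blow_up[symmetric]
proof (rule coloring_without_singular_star[where R = "red r" and g = fst])
  fix v w assume v: "v \<in> blow_up r" and w: "w \<in> blow_up r"
  have "card {x \<in> blow_up r. x \<noteq> v \<and> red r v x} = card {x \<in> blow_up r. x \<noteq> w \<and> red r w x} \<longleftrightarrow>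
        degree_drop r (fst v) = degree_drop r (fst w)"
    using card_red_add_degree_drop[OF v] card_red_add_degree_drop[OF w] by linarith
  also have "\<dots> \<longleftrightarrow> fst v = fst w"
    using degree_drop_inj v w by (metis prod.collapse)
  finally show "card {x \<in> blow_up r. x \<noteq> v \<and> red r v x} = card {x \<in> blow_up r. x \<noteq> w \<and> red r w x} \<longleftrightarrow>
        fst v = fst w" .
next
  fix v k assume v: "v \<in> blow_up r"
  obtain c a where v_eq: "v = (c, a)"
    by force
  have c: "c \<in> classes r" and a: "a < class_size r c"
    using v by (auto simp: blow_up_def v_eq)
  have "{w \<in> blow_up r. w \<noteq> v \<and> red r v w = k \<and> fst w = fst v} =
      Pair c ` {b. b < class_size r c \<and> b \<noteq> a \<and> inner_adj r c a b = k}"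
    using c by (auto simp: v_eq blow_up_def red_def)
  then have "card {w \<in> blow_up r. w \<noteq> v \<and> red r v w = k \<and> fst w = fst v} =
      card {b. b < class_size r c \<and> b \<noteq> a \<and> inner_adj r c a b = k}"
    by (simp add: card_image inj_on_def)
  also have "\<dots> \<le> 2 * r"
    using card_inner_adj[OF a] card_inner_not_adj[OF a]
    by (cases k) (auto simp: inner_degree_def split: cls.splits)
  finally show "card {w \<in> blow_up r. w \<noteq> v \<and> red r v w = k \<and> fst w = fst v} < 2 * r + 1"
    by simp
  show "card (fst ` {w \<in> blow_up r. w \<noteq> v \<and> red r v w = k \<and> fst w \<noteq> fst v}) < 2 * r + 1"
  proof (cases "r = 0")
    \<comment> \<open>The blow-up is then a single vertex, as the part \<open>Hub\<close> is empty.\<close>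
    case True
    have "{w \<in> blow_up r. w \<noteq> v \<and> red r v w = k \<and> fst w \<noteq> fst v} = {}"
      using v True by (auto simp: blow_up_def classes_def)
    then show ?thesis
      by (simp only: image_empty card.empty)
  next
    case False
    have "fst ` {w \<in> blow_up r. w \<noteq> v \<and> red r v w = k \<and> fst w \<noteq> fst v} \<subseteq>
        {d. d \<in> classes r \<and> d \<noteq> c \<and> class_adj r c d = k}"
      by (auto simp: v_eq blow_up_def red_def)
    then have "card (fst ` {w \<in> blow_up r. w \<noteq> v \<and> red r v w = k \<and> fst w \<noteq> fst v}) \<le>
        card {d. d \<in> classes r \<and> d \<noteq> c \<and> class_adj r c d = k}"
      by (intro card_mono) auto
    also have "\<dots> \<le> 2 * r"
      using class_adj_regular[OF c] card_not_adjacent_classes[OF c] False by (cases k) auto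
    finally show ?thesis
      by simp
  qed
qed (simp, simp, rule red_commute)

section \<open>The two Ramsey numbers\<close>

lemma Ramsey_number_odd_star: "Ramsey_number (star (2 * r + 1)) = 4 * r + 2"
proof -
  let ?s = "2 * r + 1"
  have iff: "(\<exists>H. subgraph H (color_graph m c k) \<and> isomorphic (star ?s) H) \<longleftrightarrow>
      (\<exists>v<m. ?s \<le> card (nbrs m c k v))" for m c k
  proof -
    have "(\<exists>S\<subseteq>nbrs m c k v. card S = ?s) \<longleftrightarrow> ?s \<le> card (nbrs m c k v)" for v
      by (metis card_mono finite_nbrs obtain_subset_with_card_n)
    then show ?thesis
      using star_in_color_graph_iff[where m = m and c = c and k = k and s = ?s and P = "\<lambda>_. True"]
      by (simp only: simp_thms)
  qed
  show ?thesis
    unfolding Ramsey_number_def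
  proof (rule Least_equality, intro allI)
    fix c
    have "?s \<le> card (nbrs (4 * r + 2) c True 0) \<or> ?s \<le> card (nbrs (4 * r + 2) c False 0)"
      using card_nbrs_add[of 0 "4 * r + 2" c] by linarith
    moreover have "0 < 4 * r + 2"
      by simp
    ultimately show "\<exists>k H. subgraph H (color_graph (4 * r + 2) c k) \<and> isomorphic (star ?s) H"
      unfolding iff by blast
  next
    fix N
    assume N: "\<forall>c. \<exists>k H. subgraph H (color_graph N c k) \<and> isomorphic (star ?s) H"
    show "4 * r + 2 \<le> N"
    proof (rule ccontr)
      assume "\<not> 4 * r + 2 \<le> N"
      then have le: "N \<le> 4 * r + 1"
        by simp
      \<comment> \<open>The circulant colouring on \<open>4r + 1\<close> vertices, restricted to the first \<open>N\<close> of them.\<close>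
      define c where "c e \<longleftrightarrow> (\<exists>a b. e = {a, b} \<and> circ r a b)" for e
      have c: "c {a, b} \<longleftrightarrow> circ r a b" for a b
        unfolding c_def doubleton_eq_iff using circ_commute by blast
      obtain k v where v: "v < N" "?s \<le> card (nbrs N c k v)"
        using N iff by blast
      have v': "v < 4 * r + 1"
        using v le by simp
      have "nbrs N c k v \<subseteq> nbrs (4 * r + 1) c k v"
        using le by (auto simp: nbrs_def)
      then have "card (nbrs N c k v) \<le> card (nbrs (4 * r + 1) c k v)"
        by (intro card_mono) auto
      also have "\<dots> = 2 * r"
      proof -
        have "card (nbrs (4 * r + 1) c True v) = 2 * r"
          using card_circ[OF v'] by (simp add: nbrs_def c)
        then show ?thesis
          using card_nbrs_add[OF v', of c] by (cases k) auto
      qed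
      finally show False
        using v(2) by simp
    qed
  qed
qed

text \<open>
  The defining condition ranges over all \<open>m \<ge> N\<close>, so a single avoiding colouring on one vertex
  fewer refutes all smaller candidates.
\<close>

lemma singular_Ramsey_number_odd_star:
  "singular_Ramsey_number (star (2 * r + 1)) = 4 * r * (4 * r + 1) + 2"
  unfolding singular_Ramsey_number_def
proof (rule Least_equality, intro allI impI)
  fix m c assume "4 * r * (4 * r + 1) + 2 \<le> m"
  then have "(2 * (2 * r + 1) - 1) * (2 * (2 * r + 1) - 2) + 2 \<le> m"
    by (simp add: algebra_simps)
  then show "\<exists>k H. subgraph H (color_graph m c k) \<and> singular H (color_graph m c k) \<and>
                   isomorphic (star (2 * r + 1)) H"
    by (intro singular_star_exists) auto
next
  fix N assume N: "\<forall>m\<ge>N. \<forall>c. \<exists>k H. subgraph H (color_graph m c k) \<and>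
      singular H (color_graph m c k) \<and> isomorphic (star (2 * r + 1)) H"
  show "4 * r * (4 * r + 1) + 2 \<le> N"
  proof (rule ccontr)
    assume "\<not> 4 * r * (4 * r + 1) + 2 \<le> N"
    then have "N \<le> 4 * r * (4 * r + 1) + 1"
      by simp
    then show False
      using N avoiding_coloring_exists[of r] by blast
  qed
qed

theorem theorem36:
  fixes s :: nat
  assumes "s \<ge> 1" and "odd s"
  shows "int (singular_Ramsey_number (star s)) =
           (int (Ramsey_number (star s)) - 1) ^ 2 + 1 - (2 * int s - 2) \<and>
         (int (Ramsey_number (star s)) - 1) ^ 2 + 1 - (2 * int s - 2) =
           (2 * int s - 1) * (2 * int s - 2) + 2"
proof -
  obtain r where "s = 2 * r + 1"
    using assms(2) by (elim oddE)
  then have "int s = 2 * int r + 1" "int (Ramsey_number (star s)) = 4 * int r + 2"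
    "int (singular_Ramsey_number (star s)) = 4 * int r * (4 * int r + 1) + 2"
    by (simp_all only: Ramsey_number_odd_star singular_Ramsey_number_odd_star)
      (simp_all add: algebra_simps)
  then show ?thesis
    by (simp add: power2_eq_square algebra_simps)
qed

end
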